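(* Let $n\ge 1$. The Zariski closure $$\overline{\bigcup_{a_2,\dots,a_n\in F}\operatorname{Orb}(\mu_1(a_2,a_3,\dots,a_n))}$$ is an irreducible component of the variety of $n$-dimensional Leibniz algebras over $F$.
   Context: $F$ is a field of characteristic zero. A (right) Leibniz algebra law on $V=F^n$ is a bilinear map $\mu=[-,-]:V\times V\to V$ with $[x,[y,z]]=[[x,y],z]-[[x,z],y]$ for all $x,y,z$. The variety of $n$-dimensional Leibniz algebras is the set of all such laws, viewed through structure constants in a fixed basis $x_1,\dots,x_n$ of $V$ as a Zariski closed subset of $F^{n^3}$ (with the induced Zariski topology). The group $GL_n(F)$ acts on it by $(f\cdot\mu)(x,y)=f^{-1}(\mu(f(x),f(y)))$ (laws in the same orbit being isomorphic), and $\operatorname{Orb}(\mu)$ denotes the orbit of $\mu$, i.e. the set of all laws isomorphic to $\mu$. For $a_2,\dots,a_n\in F$, $\mu_1(a_2,\dots,a_n)$ is the Leibniz algebra law with $$[x_i,x_1]=x_{i+1}\ (1\le i\le n-1),\qquad [x_n,x_1]=\sum_{k=2}^n a_kx_k,$$ all other products of basis elements being zero. *)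

theory Defs
  imports "HOL-Analysis.Analysis" "HOL-Library.Poly_Mapping"
begin

section \<open>Polynomials and the Zariski topology\<close>

text \<open>Multivariate polynomials with variables in \<open>'v\<close> are finitely supported maps from monomials
  (exponent vectors \<open>'v \<Rightarrow>\<^sub>0 nat\<close>) to coefficients.\<close>

type_synonym ('v, 'a) mpol = "('v \<Rightarrow>\<^sub>0 nat) \<Rightarrow>\<^sub>0 'a"

definition mpol_eval :: "('v, 'a::comm_ring_1) mpol \<Rightarrow> ('v \<Rightarrow> 'a) \<Rightarrow> 'a" where
  "mpol_eval p c = (\<Sum>m\<in>Poly_Mapping.keys p. Poly_Mapping.lookup p m *
     (\<Prod>v\<in>Poly_Mapping.keys m. c v ^ Poly_Mapping.lookup m v))"

definition zero_locus :: "('v, 'a::comm_ring_1) mpol set \<Rightarrow> ('v \<Rightarrow> 'a) set" where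
  "zero_locus P = {c. \<forall>p\<in>P. mpol_eval p c = 0}"

text \<open>The affine space is the set of all functions \<open>'v \<Rightarrow> 'a\<close>; it will be used with finite \<open>'v\<close>.\<close>

definition zariski :: "('v \<Rightarrow> 'a::field) topology" where
  "zariski = topology (\<lambda>U. \<exists>P. - U = zero_locus P)"

text \<open>The lemmas up to \<open>closedin_zariski\<close> show that the above is a topology, so that
  \<^const>\<open>topology\<close> is not applied outside its domain.\<close>

lemma mpol_eval_superset:
  assumes "finite A" "Poly_Mapping.keys p \<subseteq> A"
  shows "mpol_eval p c = (\<Sum>m\<in>A. Poly_Mapping.lookup p m *
     (\<Prod>v\<in>Poly_Mapping.keys m. c v ^ Poly_Mapping.lookup m v))"
  unfolding mpol_eval_def using assms
  by (intro sum.mono_neutral_left) (auto simp: in_keys_iff)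

lemma mpol_eval_add: "mpol_eval (p + q) c = mpol_eval p c + mpol_eval q c"
  using keys_add[of p q]
  by (simp add: mpol_eval_superset[of "Poly_Mapping.keys p \<union> Poly_Mapping.keys q"]
      lookup_add distrib_right sum.distrib)

lemma mpol_eval_0 [simp]: "mpol_eval 0 c = 0"
  by (simp add: mpol_eval_def)

lemma mpol_eval_single:
  "mpol_eval (Poly_Mapping.single m a) c =
     a * (\<Prod>v\<in>Poly_Mapping.keys m. c v ^ Poly_Mapping.lookup m v)"
  by (simp add: mpol_eval_def)

lemma mpol_eval_sum: "mpol_eval (\<Sum>i\<in>I. f i) c = (\<Sum>i\<in>I. mpol_eval (f i) c)"
  by (induction I rule: infinite_finite_induct) (simp_all add: mpol_eval_add)

lemma mpol_eval_single_mult: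
  "mpol_eval (Poly_Mapping.single m a * Poly_Mapping.single k b) c =
     mpol_eval (Poly_Mapping.single m a) c * mpol_eval (Poly_Mapping.single k b) c"
proof -
  have sup: "(\<Prod>v\<in>Poly_Mapping.keys l. c v ^ Poly_Mapping.lookup l v) =
        (\<Prod>v\<in>A. c v ^ Poly_Mapping.lookup l v)"
    if "finite A" "Poly_Mapping.keys l \<subseteq> A" for l A
    using that by (intro prod.mono_neutral_left) (auto simp: in_keys_iff)
  let ?A = "Poly_Mapping.keys m \<union> Poly_Mapping.keys k"
  have "(\<Prod>v\<in>Poly_Mapping.keys (m + k). c v ^ Poly_Mapping.lookup (m + k) v) =
      (\<Prod>v\<in>?A. c v ^ Poly_Mapping.lookup (m + k) v)"
    using keys_add[of m k] by (intro sup) auto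
  also have "\<dots> = (\<Prod>v\<in>?A. c v ^ Poly_Mapping.lookup m v) *
      (\<Prod>v\<in>?A. c v ^ Poly_Mapping.lookup k v)"
    by (simp add: lookup_add power_add prod.distrib)
  also have "\<dots> = (\<Prod>v\<in>Poly_Mapping.keys m. c v ^ Poly_Mapping.lookup m v) *
      (\<Prod>v\<in>Poly_Mapping.keys k. c v ^ Poly_Mapping.lookup k v)"
    by (intro arg_cong2[where f = "(*)"] sup[symmetric]) auto
  finally show ?thesis
    by (simp only: mult_single mpol_eval_single) (simp add: mult_ac)
qed

lemma mpol_sum_singles:
  "p = (\<Sum>m\<in>Poly_Mapping.keys p. Poly_Mapping.single m (Poly_Mapping.lookup p m))"
proof (rule poly_mapping_eqI)
  fix k
  have "(\<Sum>m\<in>Poly_Mapping.keys p. Poly_Mapping.lookup p m when m = k) = Poly_Mapping.lookup p k"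
    by (simp add: when_def in_keys_iff)
  then show "Poly_Mapping.lookup p k = Poly_Mapping.lookup
      (\<Sum>m\<in>Poly_Mapping.keys p. Poly_Mapping.single m (Poly_Mapping.lookup p m)) k"
    by (simp add: lookup_sum lookup_single)
qed

lemma mpol_eval_mult: "mpol_eval (p * q) c = mpol_eval p c * mpol_eval q c"
proof -
  let ?s = "\<lambda>p m. Poly_Mapping.single m (Poly_Mapping.lookup p m)"
  let ?P = "Poly_Mapping.keys p" and ?Q = "Poly_Mapping.keys q"
  have "p * q = (\<Sum>m\<in>?P. ?s p m) * (\<Sum>k\<in>?Q. ?s q k)"
    by (rule arg_cong2[where f = "(*)"]) (rule mpol_sum_singles)+
  then have "mpol_eval (p * q) c = mpol_eval (\<Sum>m\<in>?P. ?s p m) c * mpol_eval (\<Sum>k\<in>?Q. ?s q k) c"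
    by (simp only: sum_product mpol_eval_sum mpol_eval_single_mult)
  then show ?thesis
    by (simp only: mpol_sum_singles[symmetric])
qed

lemma zero_locus_Un:
  fixes P Q :: "('v, 'a::field) mpol set"
  shows "zero_locus P \<union> zero_locus Q = zero_locus {p * q | p q. p \<in> P \<and> q \<in> Q}"
proof (intro equalityI subsetI)
  fix c assume "c \<in> zero_locus P \<union> zero_locus Q"
  then show "c \<in> zero_locus {p * q | p q. p \<in> P \<and> q \<in> Q}"
    by (auto simp: zero_locus_def mpol_eval_mult)
next
  fix c assume *: "c \<in> zero_locus {p * q | p q. p \<in> P \<and> q \<in> Q}"
  have "mpol_eval p c = 0 \<or> mpol_eval q c = 0" if "p \<in> P" "q \<in> Q" for p q
  proof -
    have "mpol_eval (p * q) c = 0"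
      using * that unfolding zero_locus_def by blast
    then show ?thesis
      by (simp add: mpol_eval_mult)
  qed
  then show "c \<in> zero_locus P \<union> zero_locus Q"
    unfolding zero_locus_def by blast
qed

lemma istopology_zariski:
  "istopology (\<lambda>U::('v \<Rightarrow> 'a::field) set. \<exists>P. - U = zero_locus P)"
  unfolding istopology_def
proof (intro conjI allI impI)
  fix S T :: "('v \<Rightarrow> 'a) set"
  assume "\<exists>P. - S = zero_locus P" "\<exists>P. - T = zero_locus P"
  then obtain P Q where "- S = zero_locus P" "- T = zero_locus Q"
    by blast
  then have "- (S \<inter> T) = zero_locus {p * q | p q. p \<in> P \<and> q \<in> Q}"
    by (simp only: Compl_Int zero_locus_Un)
  then show "\<exists>P. - (S \<inter> T) = zero_locus P"
    by blast
next
  fix K :: "('v \<Rightarrow> 'a) set set"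
  assume "\<forall>U\<in>K. \<exists>P. - U = zero_locus P"
  then obtain P where P: "\<And>U. U \<in> K \<Longrightarrow> - U = zero_locus (P U)"
    by metis
  have "- \<Union>K = (\<Inter>U\<in>K. - U)"
    by blast
  also have "\<dots> = (\<Inter>U\<in>K. zero_locus (P U))"
    using P by simp
  also have "\<dots> = zero_locus (\<Union>U\<in>K. P U)"
    by (auto simp: zero_locus_def)
  finally show "\<exists>P. - \<Union>K = zero_locus P"
    by blast
qed

lemma openin_zariski: "openin zariski U \<longleftrightarrow> (\<exists>P. - U = zero_locus P)"
  by (simp add: zariski_def istopology_zariski)

lemma topspace_zariski [simp]: "topspace (zariski :: ('v \<Rightarrow> 'a::field) topology) = UNIV"
proof -
  have "- UNIV = zero_locus {1 :: ('v, 'a) mpol}"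
    by (simp add: zero_locus_def mpol_eval_def)
  then have "openin zariski (UNIV :: ('v \<Rightarrow> 'a) set)"
    unfolding openin_zariski by blast
  then show ?thesis
    using openin_subset by blast
qed

lemma closedin_zariski: "closedin zariski S \<longleftrightarrow> (\<exists>P. S = zero_locus P)"
  by (simp add: closedin_def openin_zariski Compl_eq_Diff_UNIV[symmetric])

section \<open>Irreducible components\<close>

definition irreducible_space :: "'a topology \<Rightarrow> bool" where
  "irreducible_space X \<longleftrightarrow> topspace X \<noteq> {} \<and>
     (\<forall>A B. closedin X A \<and> closedin X B \<and> A \<union> B = topspace X \<longrightarrow>
        A = topspace X \<or> B = topspace X)"

definition irreducible_in :: "'a topology \<Rightarrow> 'a set \<Rightarrow> bool" where
  "irreducible_in X S \<longleftrightarrow> S \<subseteq> topspace X \<and> irreducible_space (subtopology X S)"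

definition irreducible_component :: "'a topology \<Rightarrow> 'a set \<Rightarrow> bool" where
  "irreducible_component X C \<longleftrightarrow>
     irreducible_in X C \<and> (\<forall>D. irreducible_in X D \<and> C \<subseteq> D \<longrightarrow> D = C)"

section \<open>Leibniz algebra laws\<close>

type_synonym ('a, 'n) law = "'a ^ 'n \<Rightarrow> 'a ^ 'n \<Rightarrow> 'a ^ 'n"

definition bilinear_law :: "('a::field, 'n::finite) law \<Rightarrow> bool" where
  "bilinear_law \<mu> \<longleftrightarrow>
     (\<forall>x. Vector_Spaces.linear (*s) (*s) (\<lambda>y. \<mu> x y)) \<and>
     (\<forall>y. Vector_Spaces.linear (*s) (*s) (\<lambda>x. \<mu> x y))"

definition leibniz_laws :: "('a::field, 'n::finite) law set" where
  "leibniz_laws = {\<mu>. bilinear_law \<mu> \<and>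
     (\<forall>x y z. \<mu> x (\<mu> y z) = \<mu> (\<mu> x y) z - \<mu> (\<mu> x z) y)}"

definition general_linear :: "('a::field ^ 'n::finite \<Rightarrow> 'a ^ 'n) set" where
  "general_linear = {f. Vector_Spaces.linear (*s) (*s) f \<and> bij f}"

definition act :: "('a ^ 'n \<Rightarrow> 'a ^ 'n) \<Rightarrow> ('a::field, 'n::finite) law \<Rightarrow> ('a, 'n) law" where
  "act f \<mu> = (\<lambda>x y. inv f (\<mu> (f x) (f y)))"

definition Orb :: "('a::field, 'n::finite) law \<Rightarrow> ('a, 'n) law set" where
  "Orb \<mu> = {act f \<mu> | f. f \<in> general_linear}"

text \<open>The coefficient with index \<open>(i, j, k)\<close> is that of the \<open>k\<close>-th standard basis vector in the
  product of the \<open>i\<close>-th and the \<open>j\<close>-th one.\<close>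

definition structure_constants ::
  "('a::field, 'n::finite) law \<Rightarrow> ('n \<times> 'n \<times> 'n \<Rightarrow> 'a)" where
  "structure_constants \<mu> = (\<lambda>(i, j, k). \<mu> (axis i 1) (axis j 1) $ k)"

definition leibniz_variety :: "('n::finite \<times> 'n \<times> 'n \<Rightarrow> 'a::field) topology" where
  "leibniz_variety = subtopology zariski (structure_constants ` leibniz_laws)"

section \<open>The laws \<open>\<mu>\<^sub>1\<close>\<close>

text \<open>The index type \<open>'n\<close> carries no order. An enumeration \<open>e\<close>, to be a bijection from
  \<open>{1..CARD('n)}\<close> onto \<open>'n\<close>, numbers the standard basis as \<open>x\<^sub>1, \<dots>, x\<^sub>n\<close>.\<close>

definition basis_vec :: "(nat \<Rightarrow> 'n::finite) \<Rightarrow> nat \<Rightarrow> 'a::field ^ 'n" where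
  "basis_vec e i = axis (e i) 1"

definition mu1_table ::
  "(nat \<Rightarrow> 'n::finite) \<Rightarrow> (nat \<Rightarrow> 'a::field) \<Rightarrow> nat \<Rightarrow> nat \<Rightarrow> 'a ^ 'n" where
  "mu1_table e a i j =
     (if j = 1 then
        (if i < CARD('n) then basis_vec e (i + 1)
         else (\<Sum>k = 2..CARD('n). a k *s basis_vec e k))
      else 0)"

text \<open>Bilinear extension of the multiplication table; only the values \<open>a 2, \<dots>, a n\<close> matter.\<close>

definition mu1 :: "(nat \<Rightarrow> 'n::finite) \<Rightarrow> (nat \<Rightarrow> 'a::field) \<Rightarrow> ('a, 'n) law" where
  "mu1 e a = (\<lambda>x y. \<Sum>i = 1..CARD('n). \<Sum>j = 1..CARD('n).
     (x $ e i * y $ e j) *s mu1_table e a i j)"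

lemma mu1_basis_vec:
  fixes e :: "nat \<Rightarrow> 'n::finite"
  assumes e: "bij_betw e {1..CARD('n)} UNIV"
    and i: "i \<in> {1..CARD('n)}" and j: "j \<in> {1..CARD('n)}"
  shows "mu1 e a (basis_vec e i) (basis_vec e j) = mu1_table e a i j"
proof -
  have nth: "basis_vec e k $ e l = (if l = k then 1 else 0)"
    if "k \<in> {1..CARD('n)}" "l \<in> {1..CARD('n)}" for k l
    using inj_on_eq_iff[OF bij_betw_imp_inj_on[OF e], of l k] that
    by (simp add: basis_vec_def axis_def)
  have "mu1 e a (basis_vec e i) (basis_vec e j) =
      (\<Sum>k = 1..CARD('n). \<Sum>l = 1..CARD('n).
         if l = j then if k = i then mu1_table e a k l else 0 else 0)"
    unfolding mu1_def by (intro sum.cong refl) (simp add: nth[OF i] nth[OF j])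
  also have "\<dots> = (\<Sum>k = 1..CARD('n). if k = i then mu1_table e a k j else 0)"
    using j by (simp only: sum.delta finite_atLeastAtMost if_True)
  also have "\<dots> = mu1_table e a i j"
    using i by (simp only: sum.delta finite_atLeastAtMost if_True)
  finally show ?thesis .
qed

end

theory Submission
  imports Defs "HOL-Computational_Algebra.Polynomial"
begin

text \<open>In a right Leibniz algebra the left-normed powers \<open>x\<^sup>2, x\<^sup>3, \<dots>\<close> of an element are right
  annihilators. Hence, if \<open>x, x\<^sup>2, \<dots>, x\<^sup>n\<close> is a basis, the only freedom left in the law is the
  product \<open>[x\<^sup>n, x]\<close>, and its \<open>x\<close>-coefficient must vanish. So the union of the orbits consists of
  the Leibniz laws for which \<open>det (x, x\<^sup>2, \<dots>, x\<^sup>n) \<noteq> 0\<close> for some \<open>x\<close>, which is an open condition.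
  The union is also irreducible, being the image of \<open>GL\<^sub>n \<times> F\<^sup>n\<^sup>-\<^sup>1\<close> under a rational map, and the
  closure of a nonempty irreducible open set is an irreducible component.\<close>

section \<open>Irreducibility and open sets\<close>

text \<open>A closed set containing \<open>U\<close> contains its closure, so a decomposition of the
  closure is already decided on \<open>U\<close>. Stating \<open>irr\<close> with sets closed in
  \<open>X\<close> avoids the subspace topology of \<open>U\<close>.\<close>

lemma irreducible_in_closure_of:
  assumes "U \<subseteq> topspace X" "U \<noteq> {}"
    and irr: "\<And>A B. closedin X A \<Longrightarrow> closedin X B \<Longrightarrow> U \<subseteq> A \<union> B \<Longrightarrow> U \<subseteq> A \<or> U \<subseteq> B"
  shows "irreducible_in X (X closure_of U)"
  unfolding irreducible_in_def irreducible_space_def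
proof (intro conjI allI impI)
  let ?C = "X closure_of U"
  have sub: "?C \<subseteq> topspace X"
    by (rule closure_of_subset_topspace)
  have UC: "U \<subseteq> ?C"
    using assms(1) by (rule closure_of_subset)
  have top: "topspace (subtopology X ?C) = ?C"
    using sub by auto
  show "?C \<subseteq> topspace X" by fact
  show "topspace (subtopology X ?C) \<noteq> {}"
    unfolding top using UC assms(2) by blast
  fix A B
  assume AB: "closedin (subtopology X ?C) A \<and> closedin (subtopology X ?C) B
    \<and> A \<union> B = topspace (subtopology X ?C)"
  then have cl: "closedin X A" "closedin X B" and un: "A \<union> B = ?C"
    using closedin_trans_full closedin_closure_of unfolding top by blast+
  have "U \<subseteq> A \<or> U \<subseteq> B"
    using irr[OF cl] un UC by blast
  then have "?C \<subseteq> A \<or> ?C \<subseteq> B"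
    using closure_of_minimal cl by metis
  then show "A = topspace (subtopology X ?C) \<or> B = topspace (subtopology X ?C)"
    unfolding top using un by blast
qed

text \<open>\<open>D\<close> is the union of its relatively closed subsets
  \<open>D \<inter> ?C\<close> and \<open>D - U\<close>; the second is proper because
  \<open>U\<close> is a nonempty subset of \<open>D\<close>.\<close>

lemma irreducible_in_subset_closure_of_openin:
  assumes D: "irreducible_in X D" and U: "openin X U" "U \<noteq> {}" "U \<subseteq> D"
  shows "D \<subseteq> X closure_of U"
proof -
  let ?C = "X closure_of U"
  have sub: "D \<subseteq> topspace X"
    using D unfolding irreducible_in_def by blast
  then have top: "topspace (subtopology X D) = D"
    by auto
  have UC: "U \<subseteq> ?C"
    using openin_subset[OF U(1)] by (rule closure_of_subset)
  have "closedin (subtopology X D) (D \<inter> ?C)" "closedin (subtopology X D) (D - U)"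
  proof -
    have "D - U = (topspace X - U) \<inter> D"
      using sub by blast
    then show "closedin (subtopology X D) (D - U)"
      unfolding closedin_subtopology using U(1) by blast
    show "closedin (subtopology X D) (D \<inter> ?C)"
      unfolding closedin_subtopology by (metis Int_commute closedin_closure_of)
  qed
  moreover have "D \<inter> ?C \<union> (D - U) = D"
    using UC by blast
  ultimately have "D \<inter> ?C = D \<or> D - U = D"
    using D unfolding irreducible_in_def irreducible_space_def top by blast
  then show ?thesis
    using U by blast
qed

text \<open>For maximality: an irreducible set above the closure contains the open set
  \<open>U\<close>, hence lies in its closure.\<close>

lemma irreducible_component_closure_of_openin:
  assumes "openin X U" "U \<noteq> {}"
    and "\<And>A B. closedin X A \<Longrightarrow> closedin X B \<Longrightarrow> U \<subseteq> A \<union> B \<Longrightarrow> U \<subseteq> A \<or> U \<subseteq> B"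
  shows "irreducible_component X (X closure_of U)"
  unfolding irreducible_component_def
proof (intro conjI allI impI)
  have sub: "U \<subseteq> topspace X"
    using assms(1) by (rule openin_subset)
  show "irreducible_in X (X closure_of U)"
    using sub assms(2,3) by (rule irreducible_in_closure_of)
  fix D assume D: "irreducible_in X D \<and> X closure_of U \<subseteq> D"
  then have "U \<subseteq> D"
    using closure_of_subset[OF sub] by blast
  with D show "D = X closure_of U"
    using irreducible_in_subset_closure_of_openin[of X D U] assms(1,2) by blast
qed

section \<open>Polynomial functions and their non-vanishing loci\<close>

text \<open>Polynomiality as a property of functions lets determinants and iterated products be
  treated by closure rules, without writing down a polynomial.\<close>

definition polyfun :: "(('v \<Rightarrow> 'a::field) \<Rightarrow> 'a) \<Rightarrow> bool" where
  "polyfun g \<longleftrightarrow> (\<exists>p. \<forall>c. g c = mpol_eval p c)"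

lemma polyfun_const: "polyfun (\<lambda>c. a)"
  unfolding polyfun_def
  by (rule exI[of _ "Poly_Mapping.single 0 a"]) (simp add: mpol_eval_single)

lemma polyfun_var: "polyfun (\<lambda>c. c v)"
  unfolding polyfun_def
  by (rule exI[of _ "Poly_Mapping.single (Poly_Mapping.single v 1) 1"])
     (simp add: mpol_eval_single)

lemma polyfun_add: "polyfun g \<Longrightarrow> polyfun h \<Longrightarrow> polyfun (\<lambda>c. g c + h c)"
  unfolding polyfun_def by (metis mpol_eval_add)

lemma polyfun_mult: "polyfun g \<Longrightarrow> polyfun h \<Longrightarrow> polyfun (\<lambda>c. g c * h c)"
  unfolding polyfun_def by (metis mpol_eval_mult)

lemma polyfun_sum: "(\<And>i. i \<in> I \<Longrightarrow> polyfun (g i)) \<Longrightarrow> polyfun (\<lambda>c. \<Sum>i\<in>I. g i c)"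
  by (induction I rule: infinite_finite_induct) (simp_all add: polyfun_const polyfun_add)

lemma polyfun_prod: "(\<And>i. i \<in> I \<Longrightarrow> polyfun (g i)) \<Longrightarrow> polyfun (\<lambda>c. \<Prod>i\<in>I. g i c)"
  by (induction I rule: infinite_finite_induct) (simp_all add: polyfun_const polyfun_mult)

lemma polyfun_det:
  assumes "\<And>i j. polyfun (\<lambda>c. A c $ i $ j)"
  shows "polyfun (\<lambda>c. det (A c))"
  unfolding det_def using assms
  by (intro polyfun_sum polyfun_mult polyfun_const polyfun_prod)

lemma openin_zariski_nonzero:
  assumes "polyfun g"
  shows "openin zariski {c. g c \<noteq> 0}"
proof -
  obtain p where "\<And>c. g c = mpol_eval p c"
    using assms unfolding polyfun_def by blast
  then have "- {c. g c \<noteq> 0} = zero_locus {p}"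
    by (auto simp: zero_locus_def)
  then show ?thesis
    unfolding openin_zariski by blast
qed

section \<open>Rational functions of one variable\<close>

text \<open>The denominator may be any polynomial without zeros off those of \<open>d\<close>, and
  \<open>g\<close> is unconstrained at the zeros of \<open>d\<close>. This leaves room for the
  arbitrary values of \<open>inv\<close> at singular matrices.\<close>

definition rational_off :: "'a::field poly \<Rightarrow> ('a \<Rightarrow> 'a) \<Rightarrow> bool" where
  "rational_off d g \<longleftrightarrow>
     (\<exists>q r. \<forall>t. poly d t \<noteq> 0 \<longrightarrow> poly r t \<noteq> 0 \<and> g t = poly q t / poly r t)"

lemma rational_off_affine: "rational_off d (\<lambda>t. a + t * b)"
  unfolding rational_off_def by (intro exI[of _ "[:a, b:]"] exI[of _ 1]) simp

lemma rational_off_const: "rational_off d (\<lambda>t. a)"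
  using rational_off_affine[of d a 0] by simp

lemma rational_off_add:
  assumes "rational_off d g" "rational_off d h"
  shows "rational_off d (\<lambda>t. g t + h t)"
proof -
  obtain q r q' r' where
    "\<And>t. poly d t \<noteq> 0 \<Longrightarrow> poly r t \<noteq> 0 \<and> g t = poly q t / poly r t"
    "\<And>t. poly d t \<noteq> 0 \<Longrightarrow> poly r' t \<noteq> 0 \<and> h t = poly q' t / poly r' t"
    using assms unfolding rational_off_def by blast
  then show ?thesis
    unfolding rational_off_def
    by (intro exI[of _ "q * r' + q' * r"] exI[of _ "r * r'"]) (simp add: add_frac_eq)
qed

lemma rational_off_mult:
  assumes "rational_off d g" "rational_off d h"
  shows "rational_off d (\<lambda>t. g t * h t)"
proof -
  obtain q r q' r' where
    "\<And>t. poly d t \<noteq> 0 \<Longrightarrow> poly r t \<noteq> 0 \<and> g t = poly q t / poly r t"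
    "\<And>t. poly d t \<noteq> 0 \<Longrightarrow> poly r' t \<noteq> 0 \<and> h t = poly q' t / poly r' t"
    using assms unfolding rational_off_def by blast
  then show ?thesis
    unfolding rational_off_def
    by (intro exI[of _ "q * q'"] exI[of _ "r * r'"]) simp
qed

lemma rational_off_divide:
  assumes "rational_off d g"
  shows "rational_off d (\<lambda>t. g t / poly d t)"
proof -
  have "rational_off d (\<lambda>t. 1 / poly d t)"
    unfolding rational_off_def by (intro exI[of _ 1] exI[of _ d]) simp
  from rational_off_mult[OF assms this] show ?thesis
    by simp
qed

lemma rational_off_sum:
  "(\<And>i. i \<in> I \<Longrightarrow> rational_off d (g i)) \<Longrightarrow> rational_off d (\<lambda>t. \<Sum>i\<in>I. g i t)"
  by (induction I rule: infinite_finite_induct) (simp_all add: rational_off_const rational_off_add)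

lemma rational_off_prod:
  "(\<And>i. i \<in> I \<Longrightarrow> rational_off d (g i)) \<Longrightarrow> rational_off d (\<lambda>t. \<Prod>i\<in>I. g i t)"
  by (induction I rule: infinite_finite_induct) (simp_all add: rational_off_const rational_off_mult)

lemma rational_off_power: "rational_off d g \<Longrightarrow> rational_off d (\<lambda>t. g t ^ k)"
  by (induction k) (simp_all add: rational_off_const rational_off_mult)

lemma rational_off_det:
  assumes "\<And>i j. rational_off d (\<lambda>t. A t $ i $ j)"
  shows "rational_off d (\<lambda>t. det (A t))"
  unfolding det_def using assms
  by (intro rational_off_sum rational_off_mult rational_off_const rational_off_prod)

lemma rational_off_mpol_eval:
  assumes "\<And>v. rational_off d (\<lambda>t. c t v)"
  shows "rational_off d (\<lambda>t. mpol_eval p (c t))"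
  unfolding mpol_eval_def using assms
  by (intro rational_off_sum rational_off_mult rational_off_const rational_off_prod
      rational_off_power)

text \<open>The numerator serves as \<open>q\<close>. Non-vanishing at the single point
  \<open>s\<close> becomes a nonzero polynomial, and several such conditions can then be
  multiplied.\<close>

lemma rational_off_nonzero:
  assumes "rational_off d g" "poly d s \<noteq> 0" "g s \<noteq> 0"
  obtains q where "q \<noteq> 0" "\<And>t. poly d t \<noteq> 0 \<Longrightarrow> poly q t \<noteq> 0 \<Longrightarrow> g t \<noteq> 0"
proof -
  obtain q r where qr: "\<And>t. poly d t \<noteq> 0 \<Longrightarrow> poly r t \<noteq> 0 \<and> g t = poly q t / poly r t"
    using assms(1) unfolding rational_off_def by blast
  show thesis
  proof
    show "q \<noteq> 0"
      using qr[OF assms(2)] assms(3) by auto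
    show "g t \<noteq> 0" if "poly d t \<noteq> 0" "poly q t \<noteq> 0" for t
      using qr[OF that(1)] that(2) by auto
  qed
qed

text \<open>Characteristic zero makes the field infinite, so a nonzero polynomial is not the zero
  function.\<close>

lemma poly_nonzero_point:
  fixes q :: "'a::field_char_0 poly"
  assumes "q \<noteq> 0"
  obtains t where "poly q t \<noteq> 0"
  using assms poly_all_0_iff_0 by blast

lemma poly_det:
  "poly (det A) t = det (\<chi> i j. poly (A $ i $ j) t)"
proof -
  \<comment> \<open>Permutation signs enter the determinant through \<open>of_int\<close>.\<close>
  have "poly (of_int k) t = of_int k" for k
    by (cases k rule: int_cases2) simp_all
  then show ?thesis
    by (simp add: det_def poly_sum poly_prod)
qed

section \<open>The orbits of the laws \<open>\<mu>\<^sub>1\<close> form an irreducible set\<close>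

text \<open>In matrix form the group is the complement of a hypersurface in an affine space, where
  two elements can be joined by a line.\<close>

lemma general_linear_matrix:
  fixes f :: "'a::field ^ 'n::finite \<Rightarrow> 'a ^ 'n"
  shows "f \<in> general_linear \<longleftrightarrow> (\<exists>G. det G \<noteq> 0 \<and> f = (*v) G)"
proof
  assume "f \<in> general_linear"
  then have f: "Vector_Spaces.linear (*s) (*s) f" "inj f"
    unfolding general_linear_def by (auto simp: bij_def)
  have "det (matrix f) \<noteq> 0"
    using det_nz_iff_inj_gen[OF f(1)] f(2) by simp
  moreover have "f = (*v) (matrix f)"
    using matrix_works[OF f(1)] by auto
  ultimately show "\<exists>G. det G \<noteq> 0 \<and> f = (*v) G"
    by blast
next
  assume "\<exists>G. det G \<noteq> 0 \<and> f = (*v) G"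
  then obtain G where G: "det G \<noteq> 0" "f = (*v) G"
    by blast
  have "inj f" "surj f"
    using G invertible_det_nz[of G] invertible_left_inverse[of G] invertible_right_inverse[of G]
      matrix_left_invertible_injective[of G] matrix_right_invertible_surjective[of G]
    by auto
  then show "f \<in> general_linear"
    unfolding general_linear_def using G by (simp add: bij_def)
qed

text \<open>Cramer's rule, applied to the linear system with matrix \<open>G\<close> that defines
  the new product. It exhibits the structure constants as quotients with denominator
  \<open>det G\<close>.\<close>

lemma structure_constants_act:
  fixes G :: "'a::field ^ 'n::finite ^ 'n"
  assumes "det G \<noteq> 0"
  shows "structure_constants (act ((*v) G) \<mu>) (i, j, k) =
    det (\<chi> i' j'. if j' = k then \<mu> (\<chi> l. G $ l $ i) (\<chi> l. G $ l $ j) $ i' else G $ i' $ j') / det G"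
proof -
  have col: "G *v axis m 1 = (\<chi> l. G $ l $ m)" for m
    by (simp add: vec_eq_iff matrix_vector_mult_def axis_def if_distrib cong: if_cong)
  let ?y = "\<mu> (G *v axis i 1) (G *v axis j 1)"
  have "bij ((*v) G)"
    using general_linear_matrix[of "(*v) G"] assms unfolding general_linear_def by blast
  then have "G *v inv ((*v) G) ?y = ?y"
    by (simp add: bij_is_surj surj_f_inv_f)
  then have "structure_constants (act ((*v) G) \<mu>) (i, j, k) =
      det (\<chi> i' j'. if j' = k then ?y $ i' else G $ i' $ j') / det G"
    using cramer[OF assms, of "inv ((*v) G) ?y" ?y]
    by (simp add: structure_constants_def act_def)
  then show ?thesis
    by (simp only: col)
qed

lemma rational_off_mu1:
  fixes e :: "nat \<Rightarrow> 'n::finite"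
  assumes "\<And>k. rational_off d (\<lambda>t. a t k)"
    and "\<And>k. rational_off d (\<lambda>t. x t $ k)" "\<And>k. rational_off d (\<lambda>t. y t $ k)"
  shows "rational_off d (\<lambda>t. mu1 e (a t) (x t) (y t) $ l)"
proof -
  have "rational_off d (\<lambda>t. mu1_table e (a t) i j $ l)" for i j
    by (cases "j = 1"; cases "i < CARD('n)")
      (auto simp: mu1_table_def intro!: rational_off_const rational_off_sum rational_off_mult assms(1))
  then show ?thesis
    unfolding mu1_def using assms(2,3)
    by (auto intro!: rational_off_sum rational_off_mult)
qed

text \<open>Two points of the union are joined by a rational curve: the image of the line joining their
  parameters. A polynomial that does not vanish at one of its points vanishes at only finitely
  many of them.\<close>

lemma orbits_mu1_irreducible:
  fixes e :: "nat \<Rightarrow> 'n::finite" and A B :: "('n \<times> 'n \<times> 'n \<Rightarrow> 'a::field_char_0) set"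
  defines "U \<equiv> \<Union>a. structure_constants ` Orb (mu1 e a)"
  assumes A: "closedin zariski A" and B: "closedin zariski B" and sub: "U \<subseteq> A \<union> B"
  shows "U \<subseteq> A \<or> U \<subseteq> B"
proof (rule ccontr)
  assume "\<not> (U \<subseteq> A \<or> U \<subseteq> B)"
  then obtain c c' where c: "c \<in> U" "c \<notin> A" and c': "c' \<in> U" "c' \<notin> B"
    by blast
  obtain P Q where PQ: "A = zero_locus P" "B = zero_locus Q"
    using A B unfolding closedin_zariski by blast
  obtain p q where p: "p \<in> P" "mpol_eval p c \<noteq> 0" and q: "q \<in> Q" "mpol_eval q c' \<noteq> 0"
    using c(2) c'(2) PQ unfolding zero_locus_def by blast
  have U: "u \<in> U \<longleftrightarrow> (\<exists>a G. det G \<noteq> 0 \<and> u = structure_constants (act ((*v) G) (mu1 e a)))" for u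
    unfolding U_def Orb_def general_linear_matrix by blast
  obtain a G where aG: "det G \<noteq> 0" "c = structure_constants (act ((*v) G) (mu1 e a))"
    using c(1) unfolding U by blast
  obtain a' G' where aG': "det G' \<noteq> 0" "c' = structure_constants (act ((*v) G') (mu1 e a'))"
    using c'(1) unfolding U by blast
  \<comment> \<open>The line runs from \<open>(G, a)\<close> at \<open>t = 0\<close> to
    \<open>(G', a')\<close> at \<open>t = 1\<close>; \<open>d\<close> is the determinant along it as
    a polynomial in \<open>t\<close>.\<close>
  define GG where "GG t = (\<chi> i j. G $ i $ j + t * (G' $ i $ j - G $ i $ j))" for t
  define aa where "aa t k = a k + t * (a' k - a k)" for t k
  define d where "d = det (\<chi> i j. [:G $ i $ j, G' $ i $ j - G $ i $ j:])"
  define \<gamma> where "\<gamma> t = structure_constants (act ((*v) (GG t)) (mu1 e (aa t)))" for t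
  have d: "poly d t = det (GG t)" for t
    by (simp add: d_def GG_def poly_det algebra_simps)
  have ends: "GG 0 = G" "GG 1 = G'" "aa 0 = a" "aa 1 = a'"
    by (simp_all add: GG_def aa_def vec_eq_iff fun_eq_iff)
  have GG_rat: "rational_off d (\<lambda>t. GG t $ i $ j)" for i j
    by (simp add: GG_def rational_off_affine)
  have aa_rat: "rational_off d (\<lambda>t. aa t k)" for k
    by (simp add: aa_def rational_off_affine)
  have \<gamma>_rat: "rational_off d (\<lambda>t. \<gamma> t (i, j, k))" for i j k
  proof -
    let ?M = "\<lambda>t. \<chi> i' j'. if j' = k
      then mu1 e (aa t) (\<chi> l. GG t $ l $ i) (\<chi> l. GG t $ l $ j) $ i' else GG t $ i' $ j'"
    have "rational_off d (\<lambda>t. ?M t $ i' $ j')" for i' j'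
      by (cases "j' = k") (auto intro!: rational_off_mu1 GG_rat aa_rat)
    then have "rational_off d (\<lambda>t. det (?M t) / poly d t)"
      by (intro rational_off_divide rational_off_det)
    \<comment> \<open>Cramer's rule needs \<open>GG t\<close> invertible, which is why rationality
      is claimed only off the zeros of \<open>d\<close>.\<close>
    moreover have "\<gamma> t (i, j, k) = det (?M t) / poly d t" if "poly d t \<noteq> 0" for t
      using structure_constants_act[of "GG t"] that unfolding \<gamma>_def d by blast
    ultimately show ?thesis
      unfolding rational_off_def by simp
  qed
  then have rat: "rational_off d (\<lambda>t. mpol_eval r (\<gamma> t))" for r
    by (intro rational_off_mpol_eval) auto
  have d01: "poly d 0 \<noteq> 0" "poly d 1 \<noteq> 0"
    using aG aG' by (simp_all only: d ends) simp_all
  have "mpol_eval p (\<gamma> 0) \<noteq> 0" "mpol_eval q (\<gamma> 1) \<noteq> 0"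
    using p q aG aG' by (simp_all add: \<gamma>_def ends)
  then obtain p' q' where
    p': "p' \<noteq> 0" "\<And>t. poly d t \<noteq> 0 \<Longrightarrow> poly p' t \<noteq> 0 \<Longrightarrow> mpol_eval p (\<gamma> t) \<noteq> 0" and
    q': "q' \<noteq> 0" "\<And>t. poly d t \<noteq> 0 \<Longrightarrow> poly q' t \<noteq> 0 \<Longrightarrow> mpol_eval q (\<gamma> t) \<noteq> 0"
    using rational_off_nonzero[OF rat d01(1)] rational_off_nonzero[OF rat d01(2)] by metis
  have "d \<noteq> 0"
    using d01 by auto
  then have "d * p' * q' \<noteq> 0"
    using p' q' by simp
  \<comment> \<open>At such a \<open>t\<close> the matrix is invertible and neither \<open>p\<close>
    nor \<open>q\<close> vanishes on the curve, so a point of the union lies in neither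
    \<open>A\<close> nor \<open>B\<close>.\<close>
  then obtain t where t: "poly d t \<noteq> 0" "poly p' t \<noteq> 0" "poly q' t \<noteq> 0"
    by (rule poly_nonzero_point) auto
  have "\<gamma> t \<in> U"
    using t(1) unfolding U d \<gamma>_def by blast
  then have "\<gamma> t \<in> zero_locus P \<or> \<gamma> t \<in> zero_locus Q"
    using sub PQ by blast
  then show False
    using p' q' t p(1) q(1) unfolding zero_locus_def by blast
qed

section \<open>Cyclic Leibniz algebras\<close>

lemma bilinear_law_add:
  assumes "bilinear_law \<mu>"
  shows "\<mu> (x + y) z = \<mu> x z + \<mu> y z" "\<mu> z (x + y) = \<mu> z x + \<mu> z y"
  using assms unfolding bilinear_law_def Vector_Spaces.linear_iff by blast+

lemma bilinear_law_scale:
  assumes "bilinear_law \<mu>"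
  shows "\<mu> (r *s x) z = r *s \<mu> x z" "\<mu> z (r *s x) = r *s \<mu> z x"
  using assms unfolding bilinear_law_def Vector_Spaces.linear_iff by blast+

lemma bilinear_law_zero:
  assumes "bilinear_law \<mu>"
  shows "\<mu> 0 z = 0" "\<mu> z 0 = 0"
  using bilinear_law_scale(1)[OF assms, of 0 0 z] bilinear_law_scale(2)[OF assms, of z 0 0]
  by simp_all

lemma bilinear_law_sum:
  assumes "bilinear_law \<mu>"
  shows "\<mu> (sum f I) z = (\<Sum>i\<in>I. \<mu> (f i) z)" "\<mu> z (sum f I) = (\<Sum>i\<in>I. \<mu> z (f i))"
  by (induction I rule: infinite_finite_induct)
     (simp_all add: bilinear_law_add[OF assms] bilinear_law_zero[OF assms])

lemma bilinear_lawI: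
  assumes "\<And>x y z. \<mu> (x + y) z = \<mu> x z + \<mu> y z" "\<And>x y z. \<mu> z (x + y) = \<mu> z x + \<mu> z y"
    "\<And>r x z. \<mu> (r *s x) z = r *s \<mu> x z" "\<And>r x z. \<mu> z (r *s x) = r *s \<mu> z x"
  shows "bilinear_law \<mu>"
  using assms unfolding bilinear_law_def
  by (simp add: Vector_Spaces.linear_iff vec.vector_space_axioms)

lemma bilinear_law_basis_expansion:
  fixes \<mu> :: "('a::field, 'n::finite) law" and e :: "nat \<Rightarrow> 'n"
  assumes \<mu>: "bilinear_law \<mu>" and e: "bij_betw e {1..CARD('n)} UNIV"
  shows "\<mu> x y = (\<Sum>i = 1..CARD('n). \<Sum>j = 1..CARD('n).
    (x $ e i * y $ e j) *s \<mu> (basis_vec e i) (basis_vec e j))"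
proof -
  have exp: "z = (\<Sum>i = 1..CARD('n). z $ e i *s basis_vec e i)" for z :: "'a ^ 'n"
    using sum.reindex_bij_betw[OF e, of "\<lambda>i. z $ i *s axis i 1"] basis_expansion[of z]
    by (simp add: basis_vec_def)
  have "\<mu> x y = \<mu> (\<Sum>i = 1..CARD('n). x $ e i *s basis_vec e i)
      (\<Sum>j = 1..CARD('n). y $ e j *s basis_vec e j)"
    using exp[of x] exp[of y] by simp
  then show ?thesis
    unfolding bilinear_law_sum(1)[OF \<mu>] bilinear_law_scale(1)[OF \<mu>]
    unfolding bilinear_law_sum(2)[OF \<mu>] bilinear_law_scale(2)[OF \<mu>]
    by (simp add: vec.scale_sum_right)
qed

section \<open>Transport of laws by linear isomorphisms\<close>

lemma act_leibniz:
  assumes f: "f \<in> general_linear" and \<mu>: "\<mu> \<in> leibniz_laws"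
  shows "act f \<mu> \<in> leibniz_laws"
proof -
  have lin: "Vector_Spaces.linear (*s) (*s) f" and "bij f"
    using f unfolding general_linear_def by auto
  then have f_inv: "f (inv f x) = x" and inv_f: "inv f (f x) = x" for x
    by (simp_all add: bij_is_surj surj_f_inv_f bij_is_inj)
  have f_add: "f (x + y) = f x + f y" and f_scale: "f (r *s x) = r *s f x" for x y r
    using lin unfolding Vector_Spaces.linear_iff by blast+
  have g_add: "inv f (x + y) = inv f x + inv f y" and g_scale: "inv f (r *s x) = r *s inv f x" for x y r
    by (metis f_add f_inv inv_f, metis f_scale f_inv inv_f)
  have g_diff: "inv f (x - y) = inv f x - inv f y" for x y
    by (metis add_diff_cancel diff_add_cancel g_add)
  have b: "bilinear_law \<mu>" and L: "\<And>x y z. \<mu> x (\<mu> y z) = \<mu> (\<mu> x y) z - \<mu> (\<mu> x z) y"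
    using \<mu> unfolding leibniz_laws_def by blast+
  have "bilinear_law (act f \<mu>)"
    by (rule bilinear_lawI)
       (simp_all add: act_def f_add f_scale g_add g_scale bilinear_law_add[OF b] bilinear_law_scale[OF b])
  moreover have "act f \<mu> x (act f \<mu> y z) = act f \<mu> (act f \<mu> x y) z - act f \<mu> (act f \<mu> x z) y" for x y z
    by (simp add: act_def f_inv L g_diff)
  ultimately show ?thesis
    unfolding leibniz_laws_def by blast
qed

lemma general_linear_inv:
  assumes f: "f \<in> general_linear"
  shows "inv f \<in> general_linear"
proof -
  have lin: "Vector_Spaces.linear (*s) (*s) f" and bij: "bij f"
    using f unfolding general_linear_def by auto
  then have f_inv: "f (inv f x) = x" and inv_f: "inv f (f x) = x" for x
    by (simp_all add: bij_is_surj surj_f_inv_f bij_is_inj)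
  have "inv f (x + y) = inv f x + inv f y" "inv f (r *s x) = r *s inv f x" for x y r
    using lin unfolding Vector_Spaces.linear_iff by (metis f_inv inv_f)+
  then have "Vector_Spaces.linear (*s) (*s) (inv f)"
    by (simp add: Vector_Spaces.linear_iff vec.vector_space_axioms)
  then show ?thesis
    using bij_imp_bij_inv[OF bij] unfolding general_linear_def by blast
qed

lemma act_inv_act:
  assumes "f \<in> general_linear"
  shows "act (inv f) (act f \<mu>) = \<mu>"
proof -
  have "bij f"
    using assms unfolding general_linear_def by blast
  then show ?thesis
    by (simp add: act_def fun_eq_iff inv_inv_eq bij_is_surj surj_f_inv_f)
qed

text \<open>Every product is \<open>y $ e 1\<close> times \<open>R x\<close>, where \<open>R\<close>
  is right multiplication by \<open>x_1\<close>. As \<open>R\<close> takes values without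
  \<open>x_1\<close>-coordinate, \<open>[x, [y, z]]\<close> vanishes, and the two terms on the other
  side both equal \<open>y_1 z_1 R (R x)\<close>.\<close>

lemma mu1_leibniz:
  fixes e :: "nat \<Rightarrow> 'n::finite" and a :: "nat \<Rightarrow> 'a::field"
  assumes e: "bij_betw e {1..CARD('n)} UNIV"
  shows "mu1 e a \<in> leibniz_laws"
proof -
  have bil: "bilinear_law (mu1 e a)"
    by (rule bilinear_lawI)
       (simp_all add: mu1_def algebra_simps sum.distrib vec.scale_sum_right vec.scale_left_distrib)
  define R where "R x = (\<Sum>i = 1..CARD('n). x $ e i *s mu1_table e a i 1)" for x
  have one: "1 \<in> {1..CARD('n)}"
    by (simp add: Suc_leI)
  have mu: "mu1 e a x y = y $ e 1 *s R x" for x y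
  proof -
    have "mu1 e a x y = (\<Sum>i = 1..CARD('n). \<Sum>j = 1..CARD('n).
        if j = 1 then (x $ e i * y $ e 1) *s mu1_table e a i 1 else 0)"
      unfolding mu1_def by (intro sum.cong refl) (auto simp: mu1_table_def)
    also have "\<dots> = (\<Sum>i = 1..CARD('n). (x $ e i * y $ e 1) *s mu1_table e a i 1)"
      using one by (simp only: sum.delta finite_atLeastAtMost if_True)
    finally show ?thesis
      by (simp add: R_def vec.scale_sum_right mult_ac)
  qed
  have e1: "e k \<noteq> e 1" if "2 \<le> k" "k \<le> CARD('n)" for k
    using inj_on_eq_iff[OF bij_betw_imp_inj_on[OF e], of k 1] that one by auto
  \<comment> \<open>The shift leads to indices at least 2, and the sum for \<open>[x_n, x_1]\<close>
    starts at 2.\<close>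
  have "mu1_table e a i 1 $ e 1 = 0" if "i \<in> {1..CARD('n)}" for i
  proof (cases "i < CARD('n)")
    case True
    then show ?thesis
      using e1[of "i + 1"] that by (simp add: mu1_table_def basis_vec_def axis_def)
  next
    case False
    have "(basis_vec e k :: 'a ^ 'n) $ e 1 = 0" if "k \<in> {2..CARD('n)}" for k
      using e1[of k] that by (auto simp: basis_vec_def axis_def)
    with False show ?thesis
      by (simp add: mu1_table_def)
  qed
  then have R1: "R x $ e 1 = 0" for x
    by (simp add: R_def)
  have "R (r *s x) = r *s R x" for r x
    by (simp add: R_def vec.scale_sum_right)
  then have "mu1 e a x (mu1 e a y z) = mu1 e a (mu1 e a x y) z - mu1 e a (mu1 e a x z) y" for x y z
    by (simp add: mu R1[unfolded One_nat_def] mult.commute)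
  with bil show ?thesis
    unfolding leibniz_laws_def by blast
qed

section \<open>Left-normed powers and the normal form of cyclic laws\<close>

text \<open>Shifted index: the value at \<open>k\<close> is the power \<open>x^(k+1)\<close>, so
  that \<open>k < n\<close> ranges over \<open>x, ..., x^n\<close>.\<close>

primrec left_power :: "('a ^ 'n \<Rightarrow> 'a ^ 'n \<Rightarrow> 'a ^ 'n) \<Rightarrow> 'a ^ 'n \<Rightarrow> nat \<Rightarrow> 'a ^ 'n" where
  "left_power \<mu> x 0 = x"
| "left_power \<mu> x (Suc k) = \<mu> (left_power \<mu> x k) x"

text \<open>For the square, equate the last two arguments in the Leibniz identity. For the next
  power, \<open>[y, [p, x]] = [[y, p], x] - [[y, x], p]\<close>; the last term needs the induction
  hypothesis with \<open>[y, x]\<close> in place of \<open>y\<close>.\<close>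

lemma leibniz_left_power_annihilates:
  assumes "\<mu> \<in> leibniz_laws"
  shows "\<mu> y (left_power \<mu> x (Suc k)) = 0"
proof (induction k arbitrary: y)
  case 0
  then show ?case
    using assms unfolding leibniz_laws_def by simp
next
  case (Suc k)
  have "bilinear_law \<mu>" and L: "\<And>x y z. \<mu> x (\<mu> y z) = \<mu> (\<mu> x y) z - \<mu> (\<mu> x z) y"
    using assms unfolding leibniz_laws_def by blast+
  then show ?case
    unfolding left_power.simps(2)[of \<mu> x "Suc k"] L Suc.IH by (simp add: bilinear_law_zero)
qed

text \<open>The vectors \<open>x_2, ..., x_n\<close> are powers, so multiplying by them from the
  right gives zero, and the chain of powers gives the products with \<open>x_1\<close> up to the
  last one. The product \<open>[x_n, x_1]\<close> is again a power, which forces its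
  \<open>x_1\<close>-coefficient to vanish.\<close>

lemma cyclic_leibniz_eq_mu1:
  fixes e :: "nat \<Rightarrow> 'n::finite" and \<nu> :: "('a::field, 'n) law"
  assumes e: "bij_betw e {1..CARD('n)} UNIV" and \<nu>: "\<nu> \<in> leibniz_laws"
    and pow: "\<And>k. k < CARD('n) \<Longrightarrow> left_power \<nu> (basis_vec e 1) k = basis_vec e (Suc k)"
  obtains a where "\<nu> = mu1 e a"
proof -
  let ?n = "CARD('n)" and ?x = "basis_vec e 1 :: 'a ^ 'n"
  have bil: "bilinear_law \<nu>"
    using \<nu> unfolding leibniz_laws_def by blast
  have npos: "0 < ?n"
    by simp
  define a where "a k = \<nu> (basis_vec e ?n) ?x $ e k" for k
  have ann: "\<nu> y (basis_vec e j) = 0" if "j \<in> {1..?n}" "j \<noteq> 1" for y j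
  proof -
    \<comment> \<open>\<open>x_j\<close> is the power with index \<open>j - 1\<close>; annihilation
      starts at index 1, that is, at \<open>j = 2\<close>.\<close>
    have "j = Suc (Suc (j - 2))"
      using that by auto
    then obtain m where "j = Suc (Suc m)"
      by blast
    then show ?thesis
      using leibniz_left_power_annihilates[OF \<nu>, of y ?x m] pow[of "Suc m"] that by simp
  qed
  have step: "\<nu> (basis_vec e i) ?x = basis_vec e (i + 1)" if "1 \<le> i" "i < ?n" for i
    using pow[of i] pow[of "i - 1"] that left_power.simps(2)[of \<nu> ?x "i - 1"] by simp
  have last: "\<nu> (basis_vec e ?n) ?x = (\<Sum>k = 1..?n. a k *s basis_vec e k)"
    using sum.reindex_bij_betw[OF e, of "\<lambda>i. \<nu> (basis_vec e ?n) ?x $ i *s axis i 1"]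
      basis_expansion[of "\<nu> (basis_vec e ?n) ?x"]
    by (simp add: basis_vec_def a_def)
  have x_nz: "basis_vec e k \<noteq> (0 :: 'a ^ 'n)" for k
    by (simp add: basis_vec_def axis_eq_0_iff)
  text \<open>Right multiplication by \<open>[x\<^sub>n, x\<^sub>1]\<close> is \<open>a\<^sub>1\<close> times that by \<open>x\<^sub>1\<close>, but also zero.\<close>
  have "left_power \<nu> ?x (Suc (?n - 1)) = \<nu> (basis_vec e ?n) ?x"
    unfolding left_power.simps(2) using pow[of "?n - 1"] by simp
  then have "\<nu> y (\<Sum>k = 1..?n. a k *s basis_vec e k) = 0" for y
    using leibniz_left_power_annihilates[OF \<nu>, of y ?x "?n - 1"] last by simp
  moreover have "\<nu> y (\<Sum>k = 1..?n. a k *s basis_vec e k) = a 1 *s \<nu> y ?x" for y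
  proof -
    have "\<nu> y (\<Sum>k = 1..?n. a k *s basis_vec e k)
        = (\<Sum>k = 1..?n. if k = 1 then a 1 *s \<nu> y ?x else 0)"
      unfolding bilinear_law_sum[OF bil] bilinear_law_scale[OF bil]
      using ann by (intro sum.cong) auto
    also have "\<dots> = a 1 *s \<nu> y ?x"
      using npos by (subst sum.delta) auto
    finally show ?thesis .
  qed
  ultimately have a1x: "a 1 *s \<nu> y ?x = 0" for y
    by simp
  \<comment> \<open>Test with \<open>y = x_1\<close>: the relation reads
    \<open>a_1^2 x_1 = 0\<close> if \<open>n = 1\<close>, and \<open>a_1 x_2 = 0\<close>
    otherwise.\<close>
  have "a 1 = 0"
  proof (cases "?n = 1")
    case True
    then have "\<nu> ?x ?x = a 1 *s ?x"
      using last by simp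
    then show ?thesis
      using a1x[of ?x] x_nz[of 1] by simp
  next
    case False
    then show ?thesis
      using a1x[of ?x] step[of 1] x_nz[of 2] npos by (simp add: numeral_2_eq_2)
  qed
  moreover have "{1..?n} = insert 1 {2..?n}"
    using npos by auto
  ultimately have last': "\<nu> (basis_vec e ?n) ?x = (\<Sum>k = 2..?n. a k *s basis_vec e k)"
    using last by simp
  have tab: "\<nu> (basis_vec e i) (basis_vec e j) = mu1_table e a i j"
    if "i \<in> {1..?n}" "j \<in> {1..?n}" for i j
  proof (cases "j = 1")
    case True
    show ?thesis
    proof (cases "i < ?n")
      case True
      then show ?thesis
        using step[of i] that \<open>j = 1\<close> by (simp add: mu1_table_def)
    next
      case False
      then have "i = ?n"
        using that by simp
      then show ?thesis
        using last' \<open>j = 1\<close> by (simp add: mu1_table_def)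
    qed
  next
    case False
    then show ?thesis
      using ann that by (simp add: mu1_table_def)
  qed
  have "\<nu> x y = mu1 e a x y" for x y
    unfolding bilinear_law_basis_expansion[OF bil e, of x y] mu1_def
    using tab by (intro sum.cong refl) simp
  then show thesis
    using that by blast
qed

section \<open>Laws with a cyclic vector\<close>

text \<open>The columns are \<open>x, x^2, ..., x^n\<close>: \<open>inv_into\<close> recovers the
  number of a column index, and the subtraction matches the shift in
  \<open>left_power\<close>.\<close>

definition power_matrix ::
  "(nat \<Rightarrow> 'n::finite) \<Rightarrow> ('a::field, 'n) law \<Rightarrow> 'a ^ 'n \<Rightarrow> 'a ^ 'n ^ 'n" where
  "power_matrix e \<mu> x = (\<chi> i j. left_power \<mu> x (inv_into {1..CARD('n)} e j - 1) $ i)"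

lemma power_matrix_basis_vec:
  fixes e :: "nat \<Rightarrow> 'n::finite"
  assumes e: "bij_betw e {1..CARD('n)} UNIV" and k: "k < CARD('n)"
  shows "power_matrix e \<mu> x *v basis_vec e (Suc k) = left_power \<mu> x k"
proof -
  have "inv_into {1..CARD('n)} e (e (Suc k)) = Suc k"
    using bij_betw_inv_into_left[OF e, of "Suc k"] k by simp
  then show ?thesis
    by (simp add: vec_eq_iff matrix_vector_mult_def basis_vec_def axis_def power_matrix_def
        if_distrib cong: if_cong)
qed

text \<open>\<open>f\<close> is an isomorphism from the law \<open>act f \<mu>\<close> to
  \<open>\<mu>\<close>, so its inverse carries powers to powers.\<close>

lemma left_power_act:
  assumes "f \<in> general_linear"
  shows "left_power (act f \<mu>) x k = inv f (left_power \<mu> (f x) k)"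
proof (induction k)
  case 0
  have "bij f"
    using assms unfolding general_linear_def by blast
  then show ?case
    by (simp add: bij_is_inj)
next
  case (Suc k)
  have "bij f"
    using assms unfolding general_linear_def by blast
  with Suc show ?case
    by (simp add: act_def bij_is_surj surj_f_inv_f)
qed

lemma left_power_mu1:
  fixes e :: "nat \<Rightarrow> 'n::finite"
  assumes e: "bij_betw e {1..CARD('n)} UNIV"
  shows "k < CARD('n) \<Longrightarrow> left_power (mu1 e a) (basis_vec e 1) k = basis_vec e (Suc k)"
proof (induction k)
  case (Suc k)
  then show ?case
    using mu1_basis_vec[OF e, of "Suc k" 1 a] by (simp add: mu1_table_def)
qed simp

text \<open>In \<open>act f (mu1 e a)\<close> the vector \<open>inv f x_1\<close> is cyclic, and its
  power matrix is the matrix of \<open>inv f\<close>. Conversely, taking the power matrix of a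
  cyclic \<open>x\<close> as \<open>f\<close> makes \<open>x_1\<close> cyclic for
  \<open>act f \<mu>\<close> with the basis as its powers, and the normal form applies.\<close>

lemma orbits_mu1_eq_cyclic:
  fixes e :: "nat \<Rightarrow> 'n::finite"
  assumes e: "bij_betw e {1..CARD('n)} UNIV"
  shows "(\<Union>a. Orb (mu1 e a :: ('a::field, 'n) law)) =
    {\<mu> \<in> leibniz_laws. \<exists>x. det (power_matrix e \<mu> x) \<noteq> 0}"
proof (intro equalityI subsetI)
  fix \<mu> :: "('a, 'n) law"
  assume "\<mu> \<in> (\<Union>a. Orb (mu1 e a))"
  then obtain a f where f: "f \<in> general_linear" and \<mu>: "\<mu> = act f (mu1 e a)"
    unfolding Orb_def by blast
  have bij: "bij f"
    using f unfolding general_linear_def by blast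
  have inv: "inv f \<in> general_linear"
    using general_linear_inv[OF f] .
  then obtain G where G: "det G \<noteq> 0" "inv f = (*v) G"
    unfolding general_linear_matrix by blast
  let ?x = "inv f (basis_vec e 1)"
  have pow: "left_power \<mu> ?x k = G *v basis_vec e (Suc k)" if "k < CARD('n)" for k
    using left_power_mu1[OF e that, of a] bij
    by (simp add: \<mu> left_power_act[OF f] G(2)[symmetric] bij_is_surj surj_f_inv_f)
  have "power_matrix e \<mu> ?x = G"
  proof -
    have "power_matrix e \<mu> ?x *v axis j 1 = G *v axis j 1" for j
    proof -
      obtain i where "i \<in> {1..CARD('n)}" "e i = j"
        using bij_betw_imp_surj_on[OF e] by (metis UNIV_I imageE)
      then have "Suc (i - 1) = i" "i - 1 < CARD('n)"
        by auto
      then show ?thesis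
        using power_matrix_basis_vec[OF e, of "i - 1" \<mu> ?x] pow[of "i - 1"] \<open>e i = j\<close>
        by (simp add: basis_vec_def)
    qed
    then show ?thesis
      by (simp add: vec_eq_iff matrix_vector_mult_def axis_def if_distrib cong: if_cong)
  qed
  then show "\<mu> \<in> {\<mu> \<in> leibniz_laws. \<exists>x. det (power_matrix e \<mu> x) \<noteq> 0}"
    using G(1) act_leibniz[OF f mu1_leibniz[OF e]] \<mu> by auto
next
  fix \<mu> :: "('a, 'n) law"
  assume "\<mu> \<in> {\<mu> \<in> leibniz_laws. \<exists>x. det (power_matrix e \<mu> x) \<noteq> 0}"
  then obtain x where \<mu>: "\<mu> \<in> leibniz_laws" and det: "det (power_matrix e \<mu> x) \<noteq> 0"
    by blast
  define f where "f = (*v) (power_matrix e \<mu> x)"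
  have f: "f \<in> general_linear"
    using det unfolding general_linear_matrix f_def by blast
  then have "bij f"
    unfolding general_linear_def by blast
  have fb: "f (basis_vec e (Suc k)) = left_power \<mu> x k" if "k < CARD('n)" for k
    unfolding f_def by (rule power_matrix_basis_vec[OF e that])
  have "left_power (act f \<mu>) (basis_vec e 1) k = basis_vec e (Suc k)" if "k < CARD('n)" for k
    \<comment> \<open>The instance at 0 says that \<open>f\<close> sends \<open>x_1\<close> to
      \<open>x\<close>.\<close>
    using fb[OF that] fb[of 0] inv_f_f[OF bij_is_inj[OF \<open>bij f\<close>], of "basis_vec e (Suc k)"]
    by (simp add: left_power_act[OF f])
  then obtain a where "act f \<mu> = mu1 e a"
    using cyclic_leibniz_eq_mu1[OF e act_leibniz[OF f \<mu>]] by metis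
  then have "\<mu> = act (inv f) (mu1 e a)"
    using act_inv_act[OF f, of \<mu>] by simp
  then show "\<mu> \<in> (\<Union>a. Orb (mu1 e a))"
    unfolding Orb_def using general_linear_inv[OF f] by blast
qed

section \<open>Openness of the union of orbits in the variety\<close>

text \<open>Every point of the affine space is read as a bilinear law, Leibniz or not, so that
  powers are defined on the whole space and depend polynomially on \<open>c\<close>.\<close>

definition law_of :: "('n::finite \<times> 'n \<times> 'n \<Rightarrow> 'a::field) \<Rightarrow> ('a, 'n) law" where
  "law_of c x y = (\<chi> k. \<Sum>i\<in>UNIV. \<Sum>j\<in>UNIV. x $ i * y $ j * c (i, j, k))"

lemma law_of_structure_constants:
  assumes "bilinear_law \<mu>"
  shows "law_of (structure_constants \<mu>) = \<mu>"
proof (intro ext)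
  fix x y
  have "\<mu> x y = \<mu> (\<Sum>i\<in>UNIV. x $ i *s axis i 1) (\<Sum>j\<in>UNIV. y $ j *s axis j 1)"
    by (simp add: basis_expansion)
  also have "\<dots> = law_of (structure_constants \<mu>) x y"
    unfolding bilinear_law_sum(1)[OF assms] bilinear_law_scale(1)[OF assms]
    unfolding bilinear_law_sum(2)[OF assms] bilinear_law_scale(2)[OF assms]
    by (simp add: vec_eq_iff law_of_def structure_constants_def sum_distrib_left mult.assoc)
  finally show "law_of (structure_constants \<mu>) x y = \<mu> x y" ..
qed

lemma polyfun_left_power: "polyfun (\<lambda>c. left_power (law_of c) x k $ i)"
proof (induction k arbitrary: i)
  case 0
  then show ?case
    by (simp add: polyfun_const)
next
  case (Suc k)
  then show ?case
    by (auto simp: law_of_def intro!: polyfun_sum polyfun_mult polyfun_const polyfun_var)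
qed

lemma openin_orbits_mu1:
  fixes e :: "nat \<Rightarrow> 'n::finite"
  assumes e: "bij_betw e {1..CARD('n)} UNIV"
  shows "openin (leibniz_variety :: ('n \<times> 'n \<times> 'n \<Rightarrow> 'a::field) topology)
    (\<Union>a. structure_constants ` Orb (mu1 e a))"
proof -
  let ?V = "structure_constants ` leibniz_laws :: ('n \<times> 'n \<times> 'n \<Rightarrow> 'a) set"
  \<comment> \<open>For each fixed \<open>x\<close> the determinant is polynomial in
    \<open>c\<close>; the existence of a cyclic vector thus becomes a union of open sets.\<close>
  let ?N = "\<Union>x. {c. det (power_matrix e (law_of c) x) \<noteq> (0::'a)}"
  have "polyfun (\<lambda>c. det (power_matrix e (law_of c) x))" for x :: "'a ^ 'n"
    by (rule polyfun_det) (simp add: power_matrix_def polyfun_left_power)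
  then have "openin zariski ?N"
    by (intro openin_Union) (auto intro: openin_zariski_nonzero)
  moreover have "(\<Union>a. structure_constants ` Orb (mu1 e a)) = ?N \<inter> ?V"
  proof -
    have "law_of (structure_constants \<mu>) = \<mu>" if "\<mu> \<in> leibniz_laws" for \<mu> :: "('a, 'n) law"
      using that law_of_structure_constants unfolding leibniz_laws_def by blast
    then have "?N \<inter> ?V =
        structure_constants ` {\<mu> \<in> leibniz_laws. \<exists>x. det (power_matrix e \<mu> x) \<noteq> 0}"
      by (auto intro!: imageI)
    then show ?thesis
      by (simp only: orbits_mu1_eq_cyclic[OF e, symmetric] image_UN)
  qed
  ultimately show ?thesis
    unfolding leibniz_variety_def openin_subtopology by blast
qed

theorem theorem3p7:
  fixes e :: "nat \<Rightarrow> 'n::finite"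
  assumes "bij_betw e {1..CARD('n)} UNIV"
  shows "irreducible_component
    (leibniz_variety :: ('n \<times> 'n \<times> 'n \<Rightarrow> 'a::field_char_0) topology)
    (leibniz_variety closure_of (\<Union>a. structure_constants ` Orb (mu1 e a)))"
proof (rule irreducible_component_closure_of_openin)
  let ?U = "\<Union>a. structure_constants ` Orb (mu1 e a) :: ('n \<times> 'n \<times> 'n \<Rightarrow> 'a) set"
  show op: "openin leibniz_variety ?U"
    using assms by (rule openin_orbits_mu1)
  \<comment> \<open>The identity shows that orbits are nonempty.\<close>
  have "id \<in> (general_linear :: ('a ^ 'n \<Rightarrow> 'a ^ 'n) set)"
    by (simp add: general_linear_def vec.linear_id)
  then show "?U \<noteq> {}"
    unfolding Orb_def by blast
  fix A B :: "('n \<times> 'n \<times> 'n \<Rightarrow> 'a) set"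
  assume AB: "closedin leibniz_variety A" "closedin leibniz_variety B" "?U \<subseteq> A \<union> B"
  \<comment> \<open>Closed sets of the variety are traces of Zariski closed sets. Irreducibility is
    applied to the latter in the full affine space, and the result is intersected with the
    variety.\<close>
  then obtain A' B' where A': "closedin zariski A'" "A = A' \<inter> structure_constants ` leibniz_laws"
    and B': "closedin zariski B'" "B = B' \<inter> structure_constants ` leibniz_laws"
    unfolding leibniz_variety_def closedin_subtopology by blast
  have "?U \<subseteq> structure_constants ` leibniz_laws"
    using openin_subset[OF op] by (simp add: leibniz_variety_def)
  moreover have "?U \<subseteq> A' \<or> ?U \<subseteq> B'"
    using orbits_mu1_irreducible[OF A'(1) B'(1)] AB(3) A'(2) B'(2) by blast
  ultimately show "?U \<subseteq> A \<or> ?U \<subseteq> B"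
    using A'(2) B'(2) by blast
qed

end
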